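(* Let $\mathbf{k}$ be a commutative ring, $q\in\mathbf{k}$ and $r:=q+1$. Let $n$ be a positive integer and let $\gamma\in\mathrm{Comp}_n$. Then, in $\mathrm{QSym}$, $$r^nL_\gamma=\sum_{\alpha\in\mathrm{Comp}_n}(-1)^{|D(\gamma)\setminus D(\alpha)|}\,q^{|[n-1]\setminus(D(\gamma)\cup D(\alpha))|}\,\eta_\alpha^{(q)}.$$
   Context: For an integer $m$, $[m]=\{1,2,\ldots,m\}$ (empty if $m\le 0$). A composition is a finite tuple $\alpha=(\alpha_1,\ldots,\alpha_k)$ of positive integers; its length is $\ell(\alpha)=k$, its size is $|\alpha|=\alpha_1+\cdots+\alpha_k$. $\mathrm{Comp}$ is the set of all compositions (including the empty one), and $\mathrm{Comp}_n$ the set of compositions of size $n$. For $\alpha=(\alpha_1,\ldots,\alpha_k)\in\mathrm{Comp}_n$ set $D(\alpha)=\{\alpha_1+\cdots+\alpha_i \mid i\in[k-1]\}\subseteq[n-1]$. $\mathrm{QSym}\subseteq\mathbf{k}[[x_1,x_2,\ldots]]$ is the algebra of quasisymmetric functions over $\mathbf{k}$, with $\mathbf{k}$-basis $(M_\alpha)_{\alpha\in\mathrm{Comp}}$ where $M_\alpha=\sum_{i_1<i_2<\cdots<i_\ell}x_{i_1}^{\alpha_1}\cdots x_{i_\ell}^{\alpha_\ell}$ for $\alpha=(\alpha_1,\ldots,\alpha_\ell)$. For $\alpha\in\mathrm{Comp}_n$, the fundamental quasisymmetric function is $L_\alpha=\sum_{\beta\in\mathrm{Comp}_n;\ D(\beta)\supseteq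 D(\alpha)}M_\beta$. For $\alpha\in\mathrm{Comp}_n$, $\eta_\alpha^{(q)}=\sum_{\beta\in\mathrm{Comp}_n;\ D(\beta)\subseteq D(\alpha)}r^{\ell(\beta)}M_\beta\in\mathrm{QSym}$. *)

theory Defs
  imports Complex_Main "HOL-Library.Poly_Mapping"
begin

section \<open>Compositions\<close>

definition is_composition :: "nat list \<Rightarrow> bool" where
  "is_composition \<alpha> \<longleftrightarrow> (\<forall>a\<in>set \<alpha>. 0 < a)"

definition Comp :: "nat \<Rightarrow> nat list set" where
  "Comp n = {\<alpha>. is_composition \<alpha> \<and> sum_list \<alpha> = n}"

definition D :: "nat list \<Rightarrow> nat set" where
  "D \<alpha> = {sum_list (take i \<alpha>) | i. i \<in> {1..length \<alpha> - 1}}"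

lemma finite_Comp: "finite (Comp n)"
proof (rule finite_subset)
  have len: "length \<alpha> \<le> sum_list \<alpha>" if "is_composition \<alpha>" for \<alpha>
    using that by (induction \<alpha>) (auto simp: is_composition_def)
  show "Comp n \<subseteq> {xs. set xs \<subseteq> {..n} \<and> length xs \<le> n}"
    using len by (auto simp: Comp_def intro: member_le_sum_list)
  show "finite {xs. set xs \<subseteq> {..n} \<and> length xs \<le> n}"
    by (rule finite_lists_length_le) simp
qed


section \<open>Quasisymmetric functions\<close>

text \<open>
  The variables are indexed by \<^typ>\<open>nat\<close>, hence from 0. A monomial is identified with its
  exponent vector in \<^typ>\<open>nat \<Rightarrow>\<^sub>0 nat\<close>, and a formal power series with its coefficient
  function on monomials. \<open>xmonom is \<alpha>\<close> is the monomial in which the \<open>j\<close>-th variable listed in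
  \<open>is\<close> is raised to the power \<open>\<alpha> ! j\<close>.
\<close>

definition xmonom :: "nat list \<Rightarrow> nat list \<Rightarrow> (nat \<Rightarrow>\<^sub>0 nat)" where
  "xmonom is \<alpha> = (\<Sum>j<length \<alpha>. Poly_Mapping.single (is ! j) (\<alpha> ! j))"

definition total_degree :: "(nat \<Rightarrow>\<^sub>0 nat) \<Rightarrow> nat" where
  "total_degree m = (\<Sum>i\<in>Poly_Mapping.keys m. Poly_Mapping.lookup m i)"

definition increasing_indices :: "nat \<Rightarrow> nat list set" where
  "increasing_indices l = {is. length is = l \<and> sorted_wrt (<) is}"

definition quasisymmetric :: "((nat \<Rightarrow>\<^sub>0 nat) \<Rightarrow> 'k::zero) \<Rightarrow> bool" where
  "quasisymmetric f \<longleftrightarrow>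
     (\<exists>d. \<forall>m. f m \<noteq> 0 \<longrightarrow> total_degree m \<le> d) \<and>
     (\<forall>\<alpha>. is_composition \<alpha> \<longrightarrow>
        (\<forall>is\<in>increasing_indices (length \<alpha>). \<forall>js\<in>increasing_indices (length \<alpha>).
           f (xmonom is \<alpha>) = f (xmonom js \<alpha>)))"

typedef (overloaded) 'k qsym = "{f :: (nat \<Rightarrow>\<^sub>0 nat) \<Rightarrow> 'k::zero. quasisymmetric f}"
  morphisms coeff Abs_qsym
  by (rule exI[of _ "\<lambda>_. 0"]) (simp add: quasisymmetric_def)

setup_lifting type_definition_qsym

lemma quasisymmetric_add:
  fixes f g :: "(nat \<Rightarrow>\<^sub>0 nat) \<Rightarrow> 'k::monoid_add"
  assumes "quasisymmetric f" "quasisymmetric g"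
  shows "quasisymmetric (\<lambda>m. f m + g m)"
proof -
  obtain d e where "\<And>m. f m \<noteq> 0 \<Longrightarrow> total_degree m \<le> d" "\<And>m. g m \<noteq> 0 \<Longrightarrow> total_degree m \<le> e"
    using assms unfolding quasisymmetric_def by blast
  then have "\<forall>m. f m + g m \<noteq> 0 \<longrightarrow> total_degree m \<le> max d e"
    by (metis add.right_neutral max.coboundedI1 max.coboundedI2)
  moreover have "\<forall>\<alpha>. is_composition \<alpha> \<longrightarrow>
        (\<forall>is\<in>increasing_indices (length \<alpha>). \<forall>js\<in>increasing_indices (length \<alpha>).
           f (xmonom is \<alpha>) + g (xmonom is \<alpha>) = f (xmonom js \<alpha>) + g (xmonom js \<alpha>))"
    using assms unfolding quasisymmetric_def by metis
  ultimately show ?thesis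
    unfolding quasisymmetric_def by blast
qed

lemma quasisymmetric_comp:
  assumes "quasisymmetric f" "h 0 = 0"
  shows "quasisymmetric (\<lambda>m. h (f m))"
proof -
  have "\<exists>d. \<forall>m. h (f m) \<noteq> 0 \<longrightarrow> total_degree m \<le> d"
    using assms unfolding quasisymmetric_def by metis
  moreover have "\<forall>\<alpha>. is_composition \<alpha> \<longrightarrow>
        (\<forall>is\<in>increasing_indices (length \<alpha>). \<forall>js\<in>increasing_indices (length \<alpha>).
           h (f (xmonom is \<alpha>)) = h (f (xmonom js \<alpha>)))"
    using assms unfolding quasisymmetric_def by metis
  ultimately show ?thesis
    unfolding quasisymmetric_def by blast
qed

instantiation qsym :: (ab_group_add) ab_group_add
begin

lift_definition zero_qsym :: "'a qsym" is "\<lambda>_. 0"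
  by (simp add: quasisymmetric_def)

lift_definition plus_qsym :: "'a qsym \<Rightarrow> 'a qsym \<Rightarrow> 'a qsym" is "\<lambda>f g m. f m + g m"
  by (rule quasisymmetric_add)

lift_definition uminus_qsym :: "'a qsym \<Rightarrow> 'a qsym" is "\<lambda>f m. - f m"
  by (rule quasisymmetric_comp) simp_all

definition minus_qsym :: "'a qsym \<Rightarrow> 'a qsym \<Rightarrow> 'a qsym" where
  "minus_qsym f g = f + - g"

instance
  by standard (simp_all add: minus_qsym_def, (transfer, simp add: algebra_simps fun_eq_iff)+)

end

lift_definition qscale :: "'k \<Rightarrow> 'k::comm_ring_1 qsym \<Rightarrow> 'k qsym" (infixr "*\<^sub>Q" 75)
  is "\<lambda>c f m. c * f m"
  by (rule quasisymmetric_comp) simp_all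

lemma module_qscale: "module ((*\<^sub>Q) :: 'k::comm_ring_1 \<Rightarrow> _)"
  by unfold_locales (transfer, simp add: algebra_simps fun_eq_iff)+


section \<open>Monomial and fundamental quasisymmetric functions, and the enriched family\<close>

lemma lookup_xmonom:
  assumes "is \<in> increasing_indices (length \<alpha>)" "j < length \<alpha>"
  shows "Poly_Mapping.lookup (xmonom is \<alpha>) (is ! j) = \<alpha> ! j"
proof -
  have inj: "is ! i = is ! j \<longleftrightarrow> i = j" if "i < length \<alpha>" for i
    using assms that unfolding increasing_indices_def
    by (metis (mono_tags, lifting) mem_Collect_eq nat_neq_iff sorted_wrt_nth_less)
  have "Poly_Mapping.lookup (xmonom is \<alpha>) (is ! j)
      = (\<Sum>i<length \<alpha>. if i = j then \<alpha> ! i else 0)"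
    unfolding xmonom_def lookup_sum
    by (intro sum.cong refl) (auto simp: lookup_single when_def inj)
  then show ?thesis
    using assms(2) by simp
qed

lemma keys_xmonom:
  assumes "is \<in> increasing_indices (length \<alpha>)" "is_composition \<alpha>"
  shows "Poly_Mapping.keys (xmonom is \<alpha>) = set is"
proof
  have "Poly_Mapping.keys (xmonom is \<alpha>)
      \<subseteq> (\<Union>j<length \<alpha>. Poly_Mapping.keys (Poly_Mapping.single (is ! j) (\<alpha> ! j)))"
    unfolding xmonom_def by (rule keys_sum)
  also have "\<dots> \<subseteq> set is"
    using assms(1) by (auto simp: increasing_indices_def split: if_splits)
  finally show "Poly_Mapping.keys (xmonom is \<alpha>) \<subseteq> set is" .
  show "set is \<subseteq> Poly_Mapping.keys (xmonom is \<alpha>)"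
  proof
    fix i assume "i \<in> set is"
    then obtain j where j: "j < length \<alpha>" "i = is ! j"
      using assms(1) by (auto simp: in_set_conv_nth increasing_indices_def)
    then show "i \<in> Poly_Mapping.keys (xmonom is \<alpha>)"
      using lookup_xmonom[OF assms(1) j(1)] assms(2)
      by (auto simp: in_keys_iff is_composition_def)
  qed
qed

lemma xmonom_inject:
  assumes "is \<in> increasing_indices (length \<alpha>)" "is_composition \<alpha>"
    and "js \<in> increasing_indices (length \<beta>)" "is_composition \<beta>"
    and eq: "xmonom is \<alpha> = xmonom js \<beta>"
  shows "is = js \<and> \<alpha> = \<beta>"
proof -
  have "set is = set js"
    using keys_xmonom[OF assms(1,2)] keys_xmonom[OF assms(3,4)] eq by simp
  then have ij: "is = js"
    using assms(1,3) strict_sorted_equal unfolding increasing_indices_def by auto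
  then have len: "length \<alpha> = length \<beta>"
    using assms(1,3) by (simp add: increasing_indices_def)
  have "\<alpha> = \<beta>"
    using len lookup_xmonom[OF assms(1)] lookup_xmonom[OF assms(3)] eq ij
    by (auto intro!: nth_equalityI)
  with ij show ?thesis ..
qed

lemma total_degree_xmonom:
  assumes "is \<in> increasing_indices (length \<alpha>)" "is_composition \<alpha>"
  shows "total_degree (xmonom is \<alpha>) = sum_list \<alpha>"
proof -
  have d: "distinct is" and l: "length is = length \<alpha>"
    using assms(1) by (auto simp: increasing_indices_def strict_sorted_iff)
  have "total_degree (xmonom is \<alpha>)
      = sum_list (map (Poly_Mapping.lookup (xmonom is \<alpha>)) is)"
    by (simp add: total_degree_def keys_xmonom[OF assms] sum_list_distinct_conv_sum_set[OF d])
  also have "map (Poly_Mapping.lookup (xmonom is \<alpha>)) is = \<alpha>"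
    using l lookup_xmonom[OF assms(1)] by (auto intro!: nth_equalityI)
  finally show ?thesis .
qed

text \<open>
  The coefficient of a monomial in \<open>M\<^sub>\<alpha>\<close> is the number of index sequences
  \<open>i\<^sub>1 < \<cdots> < i\<^sub>l\<close> whose summand is that monomial. Lists that are not compositions
  get the dummy value 0.
\<close>

lift_definition M :: "nat list \<Rightarrow> 'k::comm_ring_1 qsym" is
  "\<lambda>\<alpha> m. if is_composition \<alpha>
         then of_nat (card {is \<in> increasing_indices (length \<alpha>). xmonom is \<alpha> = m}) else 0"
proof -
  fix \<alpha> :: "nat list"
  let ?S = "\<lambda>m. {is \<in> increasing_indices (length \<alpha>). xmonom is \<alpha> = m}"
  let ?f = "\<lambda>m. if is_composition \<alpha> then of_nat (card (?S m)) else (0::'k)"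
  have deg: "total_degree m \<le> sum_list \<alpha>" if "?f m \<noteq> 0" for m
  proof -
    from that have "is_composition \<alpha>"
      by (simp split: if_splits)
    moreover have "card (?S m) \<noteq> 0"
      using that by (metis of_nat_0)
    ultimately have c: "is_composition \<alpha>" and "card (?S m) \<noteq> 0"
      by blast+
    then have "?S m \<noteq> {}" by (metis card.empty)
    then show ?thesis
      using total_degree_xmonom[OF _ c] by auto
  qed
  have sym: "?f (xmonom is \<beta>) = ?f (xmonom js \<beta>)"
    if "is_composition \<beta>" "is \<in> increasing_indices (length \<beta>)" "js \<in> increasing_indices (length \<beta>)"
    for \<beta> "is" js
  proof -
    have "?f (xmonom ks \<beta>) = (if \<alpha> = \<beta> then 1 else 0)"
      if ks: "ks \<in> increasing_indices (length \<beta>)" for ks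
    proof (cases "is_composition \<alpha>")
      case True
      have "?S (xmonom ks \<beta>) = (if \<alpha> = \<beta> then {ks} else {})"
        using xmonom_inject[OF _ True ks \<open>is_composition \<beta>\<close>] ks by auto
      then show ?thesis using True by simp
    next
      case False
      then show ?thesis using \<open>is_composition \<beta>\<close> by auto
    qed
    then show ?thesis using that by simp
  qed
  show "quasisymmetric ?f"
    unfolding quasisymmetric_def using deg sym by blast
qed

definition L :: "nat list \<Rightarrow> 'k::comm_ring_1 qsym" where
  "L \<alpha> = (\<Sum>\<beta> | \<beta> \<in> Comp (sum_list \<alpha>) \<and> D \<beta> \<supseteq> D \<alpha>. M \<beta>)"

definition eta :: "'k::comm_ring_1 \<Rightarrow> nat list \<Rightarrow> 'k qsym" where
  "eta q \<alpha> = (\<Sum>\<beta> | \<beta> \<in> Comp (sum_list \<alpha>) \<and> D \<beta> \<subseteq> D \<alpha>. (q + 1) ^ length \<beta> *\<^sub>Q M \<beta>)"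

end

theory Submission
  imports Defs
begin

text \<open>
  Both sides are linear combinations of the \<open>M \<beta>\<close> with \<open>\<beta> \<in> Comp n\<close>, so it suffices to compare
  coefficients. On the right, expanding each \<open>eta q \<alpha>\<close> and interchanging the two sums, \<open>M \<beta>\<close> gets
  \<open>r ^ length \<beta>\<close> times the sum of the weights of all \<open>\<alpha>\<close> with \<open>D \<beta> \<subseteq> D \<alpha>\<close>. Since \<open>D\<close> is a
  bijection from \<open>Comp n\<close> to the subsets of \<open>{1..n - 1}\<close> (\<open>bij_betw_D\<close>), this is a sum over all
  subsets \<open>A\<close> of \<open>{1..n - 1}\<close> containing \<open>D \<beta>\<close>.

  The weight of \<open>A\<close> is a product of independent contributions of the elements \<open>i\<close> of
  \<open>{1..n - 1}\<close>, so the sum factors (\<open>sum_supersets_sign_power\<close>). An \<open>i \<in> D \<beta>\<close> is forced into \<open>A\<close>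
  and contributes the factor \<open>1\<close>; any other \<open>i\<close> contributes \<open>1 + (- 1) = 0\<close> if it lies in \<open>D \<gamma>\<close>, and
  \<open>1 + q = r\<close> if not. Hence the sum vanishes unless \<open>D \<gamma> \<subseteq> D \<beta>\<close>, and then it is
  \<open>r ^ (n - 1 - card (D \<beta>)) = r ^ (n - length \<beta>)\<close>. So \<open>M \<beta>\<close> has the coefficient \<open>r ^ n\<close> if
  \<open>D \<gamma> \<subseteq> D \<beta>\<close> and \<open>0\<close> otherwise, exactly as on the left.
\<close>

section \<open>Compositions and sets of partial sums\<close>

lemma D_Nil: "D [] = {}"
  by (simp add: D_def)

lemma D_singleton: "D [a] = {}"
  by (simp add: D_def)

lemma D_Cons:
  assumes "\<alpha> \<noteq> []"
  shows "D (a # \<alpha>) = insert a ((+) a ` D \<alpha>)"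
proof -
  have "{1..length (a # \<alpha>) - 1} = insert 1 (Suc ` {1..length \<alpha> - 1})"
    using assms by (cases \<alpha>) auto
  moreover have "D \<beta> = (\<lambda>i. sum_list (take i \<beta>)) ` {1..length \<beta> - 1}" for \<beta>
    by (auto simp: D_def)
  ultimately show ?thesis
    by (simp add: image_image del: image_Suc_atLeastAtMost)
qed

lemma D_pos:
  assumes "is_composition \<alpha>" "d \<in> D \<alpha>"
  shows "0 < d"
  using assms
proof (induction \<alpha> arbitrary: d)
  case (Cons a \<alpha>)
  then show ?case
    by (cases "\<alpha> = []") (auto simp: D_singleton D_Cons is_composition_def)
qed (simp add: D_Nil)

lemma D_less:
  assumes "is_composition \<alpha>" "d \<in> D \<alpha>"
  shows "d < sum_list \<alpha>"
  using assms
proof (induction \<alpha> arbitrary: d)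
  case (Cons a \<alpha>)
  have "0 < sum_list \<alpha>" if "\<alpha> \<noteq> []"
    using that Cons.prems(1) by (cases \<alpha>) (auto simp: is_composition_def)
  with Cons show ?case
    by (cases "\<alpha> = []") (auto simp: D_singleton D_Cons is_composition_def)
qed (simp add: D_Nil)

lemma D_subset:
  assumes "\<alpha> \<in> Comp n"
  shows "D \<alpha> \<subseteq> {1..n - 1}"
  using assms D_pos D_less unfolding Comp_def by fastforce

lemma card_D:
  assumes "is_composition \<alpha>"
  shows "card (D \<alpha>) = length \<alpha> - 1"
  using assms
proof (induction \<alpha>)
  case (Cons a \<alpha>)
  show ?case
  proof (cases "\<alpha> = []")
    case False
    have c: "is_composition \<alpha>"
      using Cons.prems by (simp add: is_composition_def)
    have "finite (D \<alpha>)"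
      by (simp add: D_def)
    moreover have "a \<notin> (+) a ` D \<alpha>"
      using D_pos[OF c] by fastforce
    ultimately have "card (D (a # \<alpha>)) = Suc (card (D \<alpha>))"
      using False by (simp add: D_Cons card_image)
    then show ?thesis
      using False Cons.IH[OF c] by simp
  qed (simp add: D_singleton)
qed (simp add: D_Nil)

text \<open>
  For nonempty \<open>\<alpha>\<close> and \<open>\<beta>\<close>, equality of \<open>D \<alpha>\<close> and \<open>D \<beta>\<close> forces equal lengths. If there are at least
  two parts, the first part is the minimum of the set of partial sums; removing it and shifting
  the rest down reduces the claim to the tails.
\<close>
lemma D_inject:
  assumes "is_composition \<alpha>" "is_composition \<beta>" "sum_list \<alpha> = sum_list \<beta>" "D \<alpha> = D \<beta>"
  shows "\<alpha> = \<beta>"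
  using assms
proof (induction \<alpha> arbitrary: \<beta>)
  case Nil
  then show ?case
    by (cases \<beta>) (auto simp: is_composition_def)
next
  case (Cons a \<alpha>)
  then obtain b \<beta>' where \<beta>: "\<beta> = b # \<beta>'"
    by (cases \<beta>) (auto simp: is_composition_def)
  have c: "is_composition \<alpha>" "is_composition \<beta>'"
    using Cons.prems \<beta> by (simp_all add: is_composition_def)
  have "length \<alpha> = length \<beta>'"
    using card_D[OF Cons.prems(1)] card_D[OF Cons.prems(2)] Cons.prems(4) \<beta> by simp
  show ?case
  proof (cases "\<alpha> = []")
    case True
    then show ?thesis
      using \<open>length \<alpha> = length \<beta>'\<close> Cons.prems(3) \<beta> by simp
  next
    case False
    then have "\<beta>' \<noteq> []"
      using \<open>length \<alpha> = length \<beta>'\<close> by auto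
    have D: "insert a ((+) a ` D \<alpha>) = insert b ((+) b ` D \<beta>')"
      using Cons.prems(4) \<beta> False \<open>\<beta>' \<noteq> []\<close> by (simp add: D_Cons)
    have new: "a \<notin> (+) a ` D \<alpha>" "b \<notin> (+) b ` D \<beta>'"
      using D_pos[OF c(1)] D_pos[OF c(2)] by fastforce+
    \<comment> \<open>The first part of a composition is the least partial sum.\<close>
    have "b \<in> insert a ((+) a ` D \<alpha>)" "a \<in> insert b ((+) b ` D \<beta>')"
      using D by blast+
    then have "a \<le> b" "b \<le> a"
      by auto
    then have "a = b" by simp
    with D new have "(+) a ` D \<alpha> = (+) a ` D \<beta>'"
      by (metis insert_ident)
    then have "D \<alpha> = D \<beta>'"
      by (simp add: inj_image_eq_iff)
    then show ?thesis
      using Cons.IH[OF c] Cons.prems(3) \<beta> \<open>a = b\<close> by simp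
  qed
qed

text \<open>
  The minimum of \<open>S\<close> is taken as the first part; the remaining elements, shifted down by it, are the
  partial sums of the tail.
\<close>
lemma D_surj:
  assumes "0 < n" "S \<subseteq> {1..n - 1}"
  shows "\<exists>\<alpha>\<in>Comp n. D \<alpha> = S"
  using assms
proof (induction n arbitrary: S rule: less_induct)
  case (less n)
  show ?case
  proof (cases "S = {}")
    case True
    then have "[n] \<in> Comp n" "D [n] = S"
      using less.prems by (simp_all add: Comp_def is_composition_def D_singleton)
    then show ?thesis ..
  next
    case False
    have fin: "finite S"
      using less.prems(2) finite_subset by blast
    define m where "m = Min S"
    have m: "m \<in> S" "\<And>s. s \<in> S \<Longrightarrow> m \<le> s"
      using fin False by (simp_all add: m_def)
    define T where "T = (\<lambda>s. s - m) ` (S - {m})"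
    have "0 < m" "m < n"
      using m(1) less.prems by force+
    have "T \<subseteq> {1..n - m - 1}"
    proof
      fix t assume "t \<in> T"
      then obtain s where "s \<in> S" "s \<noteq> m" "t = s - m"
        by (auto simp: T_def)
      moreover from this have "m \<le> s" "s \<le> n - 1"
        using m(2) less.prems(2) by auto
      ultimately show "t \<in> {1..n - m - 1}" by auto
    qed
    then obtain \<alpha> where \<alpha>: "\<alpha> \<in> Comp (n - m)" "D \<alpha> = T"
      using less.IH[of "n - m" T] \<open>0 < m\<close> \<open>m < n\<close> by auto
    have "\<alpha> \<noteq> []"
      using \<alpha>(1) \<open>m < n\<close> by (auto simp: Comp_def)
    have "(+) m ` T = S - {m}"
      using m(2) by (force simp: T_def image_image)
    then have "D (m # \<alpha>) = S"
      using \<open>\<alpha> \<noteq> []\<close> \<alpha>(2) m(1) by (auto simp: D_Cons)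
    moreover have "m # \<alpha> \<in> Comp n"
      using \<alpha>(1) \<open>0 < m\<close> \<open>m < n\<close> by (auto simp: Comp_def is_composition_def)
    ultimately show ?thesis by blast
  qed
qed

lemma bij_betw_D:
  assumes "0 < n"
  shows "bij_betw D (Comp n) (Pow {1..n - 1})"
proof (rule bij_betw_imageI)
  show "inj_on D (Comp n)"
    by (rule inj_onI) (simp add: Comp_def D_inject)
  show "D ` Comp n = Pow {1..n - 1}"
    using D_subset D_surj[OF assms] by blast
qed

section \<open>Weighted sums over supersets\<close>

text \<open>
  The weight of \<open>A\<close> is the product over \<open>N - A\<close> of \<open>- 1\<close> on \<open>G\<close> and \<open>q\<close> off \<open>G\<close>; replacing this factor
  by \<open>0\<close> on \<open>B\<close> kills exactly the sets \<open>A\<close> that do not contain \<open>B\<close>. The sum over all \<open>A \<subseteq> N\<close> then is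
  the expansion of a product over \<open>N\<close>, whose factors are \<open>1\<close> on \<open>B\<close>, and outside \<open>B\<close> they are
  \<open>0\<close> on \<open>G\<close> and \<open>q + 1\<close> elsewhere.
\<close>
lemma sum_supersets_sign_power:
  fixes q :: "'k::comm_ring_1"
  assumes "finite N" "G \<subseteq> N" "B \<subseteq> N"
  shows "(\<Sum>A | A \<subseteq> N \<and> B \<subseteq> A. (- 1) ^ card (G - A) * q ^ card (N - (G \<union> A)))
    = (if G \<subseteq> B then (q + 1) ^ card (N - B) else 0)"
proof -
  let ?g = "\<lambda>i. if i \<in> B then 0 else if i \<in> G then - 1 else q"
  have w: "prod ?g (N - A) = (if B \<subseteq> A then (- 1) ^ card (G - A) * q ^ card (N - (G \<union> A)) else 0)"
    if "A \<subseteq> N" for A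
  proof (cases "B \<subseteq> A")
    case True
    have "N - A = (G - A) \<union> (N - (G \<union> A))"
      using assms(2) by blast
    also have "prod ?g \<dots> = prod ?g (G - A) * prod ?g (N - (G \<union> A))"
      using assms(1,2) by (intro prod.union_disjoint) (auto intro: finite_subset)
    also have "prod ?g (G - A) = (\<Prod>i\<in>G - A. - 1)"
      using True by (intro prod.cong) auto
    also have "prod ?g (N - (G \<union> A)) = (\<Prod>i\<in>N - (G \<union> A). q)"
      using True by (intro prod.cong) auto
    finally show ?thesis
      using True by simp
  next
    case False
    then have "\<exists>i\<in>N - A. ?g i = 0"
      using assms(3) by auto
    then show ?thesis
      using False assms(1) by (simp add: prod_zero)
  qed
  have "(\<Sum>A | A \<subseteq> N \<and> B \<subseteq> A. (- 1) ^ card (G - A) * q ^ card (N - (G \<union> A)))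
      = (\<Sum>A\<in>Pow N. prod ?g (N - A))"
    using assms(1) by (intro sum.mono_neutral_cong_left) (auto simp: w)
  also have "\<dots> = (\<Prod>i\<in>N. 1 + ?g i)"
    using prod_add[OF assms(1), of "\<lambda>_. 1" ?g] by simp
  also have "\<dots> = (if G \<subseteq> B then (q + 1) ^ card (N - B) else 0)"
  proof (cases "G \<subseteq> B")
    case True
    have "(\<Prod>i\<in>N. 1 + ?g i) = (\<Prod>i\<in>N - B. q + 1)"
      using True assms(1) by (intro prod.mono_neutral_cong_right) (auto simp: add.commute)
    then show ?thesis
      using True by simp
  next
    case False
    then have "\<exists>i\<in>N. 1 + ?g i = 0"
      using assms(2) by auto
    then show ?thesis
      using False assms(1) by (simp add: prod_zero)
  qed
  finally show ?thesis .
qed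

section \<open>The expansion in the enriched family\<close>

theorem proposition3p12:
  fixes q r :: "'k::comm_ring_1" and n :: nat and \<gamma> :: "nat list"
  assumes "r = q + 1" and "0 < n" and "\<gamma> \<in> Comp n"
  shows "r ^ n *\<^sub>Q L \<gamma> =
    (\<Sum>\<alpha>\<in>Comp n.
       ((- 1) ^ card (D \<gamma> - D \<alpha>) * q ^ card ({1..n - 1} - (D \<gamma> \<union> D \<alpha>))) *\<^sub>Q eta q \<alpha>)"
proof -
  interpret module "(*\<^sub>Q) :: 'k \<Rightarrow> _"
    by (rule module_qscale)
  let ?N = "{1..n - 1}"
  \<comment> \<open>The weight depends on \<open>\<alpha>\<close> only through \<open>D \<alpha>\<close>, which allows the passage from compositions to sets.\<close>
  let ?w = "\<lambda>A. (- 1) ^ card (D \<gamma> - A) * q ^ card (?N - (D \<gamma> \<union> A)) :: 'k"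
  \<comment> \<open>The coefficient of \<open>M \<beta>\<close> on the right-hand side.\<close>
  have coeff: "(\<Sum>\<alpha> | \<alpha> \<in> Comp n \<and> D \<beta> \<subseteq> D \<alpha>. ?w (D \<alpha>)) * r ^ length \<beta>
      = (if D \<gamma> \<subseteq> D \<beta> then r ^ n else 0)" if \<beta>: "\<beta> \<in> Comp n" for \<beta>
  proof -
    have "bij_betw D {\<alpha> \<in> Comp n. D \<beta> \<subseteq> D \<alpha>} {A. A \<subseteq> ?N \<and> D \<beta> \<subseteq> A}"
    proof (rule bij_betw_imageI)
      show "inj_on D {\<alpha> \<in> Comp n. D \<beta> \<subseteq> D \<alpha>}"
        using bij_betw_D[OF assms(2)] by (auto simp: bij_betw_def intro: inj_on_subset)
      show "D ` {\<alpha> \<in> Comp n. D \<beta> \<subseteq> D \<alpha>} = {A. A \<subseteq> ?N \<and> D \<beta> \<subseteq> A}"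
        using D_subset D_surj[OF assms(2)] by blast
    qed
    then have "(\<Sum>\<alpha> | \<alpha> \<in> Comp n \<and> D \<beta> \<subseteq> D \<alpha>. ?w (D \<alpha>)) = (\<Sum>A | A \<subseteq> ?N \<and> D \<beta> \<subseteq> A. ?w A)"
      by (rule sum.reindex_bij_betw)
    also have "\<dots> = (if D \<gamma> \<subseteq> D \<beta> then r ^ card (?N - D \<beta>) else 0)"
      using sum_supersets_sign_power[of ?N "D \<gamma>" "D \<beta>" q] D_subset[OF assms(3)] D_subset[OF \<beta>] assms(1)
      by simp
    finally have sum: "(\<Sum>\<alpha> | \<alpha> \<in> Comp n \<and> D \<beta> \<subseteq> D \<alpha>. ?w (D \<alpha>)) = \<dots>" .
    have "card (?N - D \<beta>) + length \<beta> = n"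
    proof -
      have "card (D \<beta>) = length \<beta> - 1"
        using \<beta> by (simp add: Comp_def card_D)
      moreover have "0 < length \<beta>"
        using \<beta> assms(2) by (auto simp: Comp_def)
      moreover have "card (D \<beta>) \<le> card ?N" "card (?N - D \<beta>) = card ?N - card (D \<beta>)"
        using D_subset[OF \<beta>] finite_subset[OF D_subset[OF \<beta>]]
        by (auto intro: card_mono[OF finite_atLeastAtMost] card_Diff_subset simp del: card_atLeastAtMost One_nat_def)
      ultimately show ?thesis
        using assms(2) by simp
    qed
    then show ?thesis
      unfolding sum by (simp flip: power_add)
  qed
  have "(\<Sum>\<alpha>\<in>Comp n. ?w (D \<alpha>) *\<^sub>Q eta q \<alpha>)
      = (\<Sum>\<alpha>\<in>Comp n. \<Sum>\<beta> | \<beta> \<in> Comp n \<and> D \<beta> \<subseteq> D \<alpha>. (?w (D \<alpha>) * r ^ length \<beta>) *\<^sub>Q M \<beta>)"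
    using assms(1) by (intro sum.cong refl) (simp add: eta_def Comp_def scale_sum_right)
  also have "\<dots> = (\<Sum>\<beta>\<in>Comp n. \<Sum>\<alpha> | \<alpha> \<in> Comp n \<and> D \<beta> \<subseteq> D \<alpha>. (?w (D \<alpha>) * r ^ length \<beta>) *\<^sub>Q M \<beta>)"
    by (rule sum.swap_restrict) (simp_all add: finite_Comp)
  also have "\<dots> = (\<Sum>\<beta>\<in>Comp n. (if D \<gamma> \<subseteq> D \<beta> then r ^ n else 0) *\<^sub>Q M \<beta>)"
    by (intro sum.cong refl) (simp only: coeff flip: scale_sum_left sum_distrib_right)
  also have "\<dots> = (\<Sum>\<beta> | \<beta> \<in> Comp n \<and> D \<gamma> \<subseteq> D \<beta>. r ^ n *\<^sub>Q M \<beta>)"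
    by (intro sum.mono_neutral_cong_right) (auto simp: finite_Comp)
  also have "\<dots> = r ^ n *\<^sub>Q L \<gamma>"
    using assms(3) by (simp add: L_def Comp_def scale_sum_right)
  finally show ?thesis ..
qed

end
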